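(* Let $G$ be a finite group of order $>2$ that is of odd order, or nilpotent, or quasisimple. Then $G$ does not have full extended Reidemeister spectrum, i.e. $\mathrm{ESpec}_R(G)\neq\{1,\ldots,k(G)\}$.
   Context: A group $G$ is called quasisimple if $G$ is perfect, i.e. $G=[G,G]$, and $G/Z(G)$ is simple, where $Z(G)$ is the centre of $G$. For an endomorphism $\varphi$ of a group $G$, two elements $g_1,g_2\in G$ are $\varphi$-twisted conjugate if there is $h\in G$ with $g_1=hg_2\varphi(h)^{-1}$; this is an equivalence relation, and the Reidemeister number $R(\varphi)$ is the number of its equivalence classes. The extended Reidemeister spectrum is $\mathrm{ESpec}_R(G)=\{R(\varphi)\mid \varphi\in\mathrm{End}(G)\}$. $k(G)$ is the number of conjugacy classes of $G$. A finite group $G$ has full extended Reidemeister spectrum if $\mathrm{ESpec}_R(G)=\{1,\ldots,k(G)\}$. *)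

theory Defs
  imports "HOL-Algebra.Algebra"
begin

definition center :: "('a, 'b) monoid_scheme \<Rightarrow> 'a set" where
  "center G = {z \<in> carrier G. \<forall>g \<in> carrier G. z \<otimes>\<^bsub>G\<^esub> g = g \<otimes>\<^bsub>G\<^esub> z}"

lemma (in group) center_normal: "center G \<lhd> G"
proof -
  have comm: "z \<in> carrier G" "\<And>g. g \<in> carrier G \<Longrightarrow> z \<otimes> g = g \<otimes> z" if "z \<in> center G" for z
    using that by (simp_all add: center_def)
  have centerI: "z \<in> center G"
    if "z \<in> carrier G" "\<And>g. g \<in> carrier G \<Longrightarrow> z \<otimes> g = g \<otimes> z" for z
    using that by (simp add: center_def)
  have "subgroup (center G) G"
  proof (rule subgroupI)
    show "center G \<subseteq> carrier G"
      using comm(1) by blast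
    have "\<one> \<in> center G"
      by (rule centerI) simp_all
    then show "center G \<noteq> {}"
      by blast
  next
    fix z assume z: "z \<in> center G"
    show "inv z \<in> center G"
    proof (rule centerI)
      fix g assume g: "g \<in> carrier G"
      have "inv z \<otimes> g = inv z \<otimes> (g \<otimes> z) \<otimes> inv z"
        using comm(1)[OF z] g by (simp add: m_assoc)
      also have "\<dots> = inv z \<otimes> (z \<otimes> g) \<otimes> inv z"
        by (simp only: comm(2)[OF z g])
      also have "\<dots> = g \<otimes> inv z"
        using comm(1)[OF z] g by (simp add: m_assoc[symmetric])
      finally show "inv z \<otimes> g = g \<otimes> inv z" .
    qed (use comm(1)[OF z] in simp)
  next
    fix x y assume x: "x \<in> center G" and y: "y \<in> center G"
    note xy = comm(1)[OF x] comm(1)[OF y]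
    show "x \<otimes> y \<in> center G"
    proof (rule centerI)
      fix g assume g: "g \<in> carrier G"
      have "x \<otimes> y \<otimes> g = x \<otimes> (y \<otimes> g)"
        using xy g by (simp only: m_assoc)
      also have "\<dots> = x \<otimes> g \<otimes> y"
        using xy g by (simp only: comm(2)[OF y g] m_assoc)
      also have "\<dots> = g \<otimes> (x \<otimes> y)"
        using xy g by (simp only: comm(2)[OF x g] m_assoc)
      finally show "x \<otimes> y \<otimes> g = g \<otimes> (x \<otimes> y)" .
    qed (use xy in simp)
  qed
  moreover have "g \<otimes> z \<otimes> inv g \<in> center G"
    if g: "g \<in> carrier G" and z: "z \<in> center G" for g z
  proof -
    have "g \<otimes> z \<otimes> inv g = z \<otimes> g \<otimes> inv g"
      by (simp only: comm(2)[OF z g])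
    also have "\<dots> = z"
      using comm(1)[OF z] g by (simp add: m_assoc)
    finally show ?thesis
      using z by simp
  qed
  ultimately show ?thesis
    by (simp add: normal_inv_iff)
qed

definition perfect :: "('a, 'b) monoid_scheme \<Rightarrow> bool" where
  "perfect G \<longleftrightarrow> group G \<and> derived G (carrier G) = carrier G"

definition quasisimple :: "('a, 'b) monoid_scheme \<Rightarrow> bool" where
  "quasisimple G \<longleftrightarrow> perfect G \<and> simple_group (G Mod center G)"

definition commutator_subgroup :: "('a, 'b) monoid_scheme \<Rightarrow> 'a set \<Rightarrow> 'a set \<Rightarrow> 'a set" where
  "commutator_subgroup G H K =
     generate G {h \<otimes>\<^bsub>G\<^esub> k \<otimes>\<^bsub>G\<^esub> inv\<^bsub>G\<^esub> h \<otimes>\<^bsub>G\<^esub> inv\<^bsub>G\<^esub> k | h k. h \<in> H \<and> k \<in> K}"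

primrec lower_central_series :: "('a, 'b) monoid_scheme \<Rightarrow> nat \<Rightarrow> 'a set" where
  "lower_central_series G 0 = carrier G"
| "lower_central_series G (Suc n) =
     commutator_subgroup G (lower_central_series G n) (carrier G)"

definition nilpotent_group :: "('a, 'b) monoid_scheme \<Rightarrow> bool" where
  "nilpotent_group G \<longleftrightarrow> group G \<and> (\<exists>n. lower_central_series G n = {\<one>\<^bsub>G\<^esub>})"

definition twisted_conj :: "('a, 'b) monoid_scheme \<Rightarrow> ('a \<Rightarrow> 'a) \<Rightarrow> 'a rel" where
  "twisted_conj G \<phi> =
     {(g1, g2). g1 \<in> carrier G \<and> g2 \<in> carrier G \<and>
        (\<exists>h \<in> carrier G. g1 = h \<otimes>\<^bsub>G\<^esub> g2 \<otimes>\<^bsub>G\<^esub> inv\<^bsub>G\<^esub> (\<phi> h))}"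

lemma (in group) equiv_twisted_conj:
  assumes "\<phi> \<in> hom G G"
  shows "equiv (carrier G) (twisted_conj G \<phi>)"
proof -
  interpret group_hom G G \<phi>
    using assms by unfold_locales
  show ?thesis
  proof (rule equivI)
    show "twisted_conj G \<phi> \<subseteq> carrier G \<times> carrier G"
      by (auto simp: twisted_conj_def)
    show "refl_on (carrier G) (twisted_conj G \<phi>)"
      by (auto simp: refl_on_def twisted_conj_def intro!: bexI[of _ \<one>])
    show "sym (twisted_conj G \<phi>)"
    proof (rule symI)
      fix x y assume "(x, y) \<in> twisted_conj G \<phi>"
      then obtain h where *: "x \<in> carrier G" "y \<in> carrier G" "h \<in> carrier G"
        "x = h \<otimes> y \<otimes> inv (\<phi> h)"
        by (auto simp: twisted_conj_def)
      have "y = inv h \<otimes> x \<otimes> inv (\<phi> (inv h))"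
        using *(2,3) unfolding *(4) by (simp add: m_assoc) (simp add: m_assoc[symmetric])
      then have "\<exists>k \<in> carrier G. y = k \<otimes> x \<otimes> inv (\<phi> k)"
        using *(3) by (intro bexI[of _ "inv h"]) simp_all
      then show "(y, x) \<in> twisted_conj G \<phi>"
        using *(1,2) by (simp add: twisted_conj_def)
    qed
    show "trans (twisted_conj G \<phi>)"
    proof (rule transI)
      fix x y z assume "(x, y) \<in> twisted_conj G \<phi>" "(y, z) \<in> twisted_conj G \<phi>"
      then obtain h k where *: "x \<in> carrier G" "z \<in> carrier G" "h \<in> carrier G" "k \<in> carrier G"
        "x = h \<otimes> y \<otimes> inv (\<phi> h)" "y = k \<otimes> z \<otimes> inv (\<phi> k)"
        by (auto simp: twisted_conj_def)
      have "x = (h \<otimes> k) \<otimes> z \<otimes> inv (\<phi> (h \<otimes> k))"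
        using *(2-4) unfolding *(5,6) by (simp add: m_assoc inv_mult_group)
      then have "\<exists>l \<in> carrier G. x = l \<otimes> z \<otimes> inv (\<phi> l)"
        using *(3,4) by (intro bexI[of _ "h \<otimes> k"]) simp_all
      then show "(x, z) \<in> twisted_conj G \<phi>"
        using *(1,2) by (simp add: twisted_conj_def)
    qed
  qed
qed

text \<open>
  The cardinality is a natural number, so this is the Reidemeister number only when there are
  finitely many classes (an infinite class set would give 0); it is used for finite groups only.
\<close>
definition reidemeister_number :: "('a, 'b) monoid_scheme \<Rightarrow> ('a \<Rightarrow> 'a) \<Rightarrow> nat" where
  "reidemeister_number G \<phi> = card (carrier G // twisted_conj G \<phi>)"

definition ext_reidemeister_spectrum :: "('a, 'b) monoid_scheme \<Rightarrow> nat set" where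
  "ext_reidemeister_spectrum G = reidemeister_number G ` hom G G"

definition conj_class_number :: "('a, 'b) monoid_scheme \<Rightarrow> nat" where
  "conj_class_number G =
     card (orbits G (carrier G) (\<lambda>g. \<lambda>h \<in> carrier G. g \<otimes>\<^bsub>G\<^esub> h \<otimes>\<^bsub>G\<^esub> inv\<^bsub>G\<^esub> g))"

definition full_ext_reidemeister_spectrum :: "('a, 'b) monoid_scheme \<Rightarrow> bool" where
  "full_ext_reidemeister_spectrum G \<longleftrightarrow>
     ext_reidemeister_spectrum G = {1..conj_class_number G}"

end

theory Submission
  imports Defs
begin

text \<open>
  Let \<open>\<phi>\<close> be an endomorphism of the finite group \<open>G\<close>. The value missing from the spectrum is \<open>2\<close> if
  \<open>|G|\<close> is odd, and \<open>k(G) - 1\<close> otherwise.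

  If \<open>|G|\<close> is odd, then \<open>R(\<phi>)\<close> is odd: the \<open>\<phi>\<close>-twisted conjugacy classes are the orbits of an action
  of \<open>G\<close>, so their sizes are odd, and they add up to the odd number \<open>|G|\<close>. A nontrivial group has
  \<open>k(G) \<ge> 2\<close>, and the value \<open>2\<close> is never attained
  (\<open>odd_reidemeister_number\<close>).

  In the other two cases the value \<open>k(G) - 1\<close> is not attained. Counting the pairs \<open>(h, g)\<close> with
  \<open>h g \<phi>(h)\<inverse> = g\<close> in two ways shows that \<open>R(\<phi>)\<close> is the number of conjugacy classes that \<open>\<phi>\<close> maps into
  themselves (\<open>reidemeister_number_eq_fixed_classes\<close>), so \<open>R(\<phi>) = k(G) - 1\<close> means that \<open>\<phi>\<close> moves exactly
  one class. An automorphism permutes the classes and cannot move just one, hence \<open>\<phi>\<close> has a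
  nontrivial kernel, and every element \<open>\<noteq> \<one>\<close> of the kernel lies in the moved class.
  In a nilpotent group the kernel contains a central element \<open>z \<noteq> \<one>\<close>; in a quasisimple group it does
  too, unless it is all of \<open>G\<close>, which then has only two classes and therefore order \<open>2\<close>.
  If \<open>z\<close> is central, the moved class is \<open>{z}\<close>, the kernel is \<open>{\<one>, z}\<close>, and \<open>\<phi>\<close> sends
  every \<open>g \<noteq> z\<close> to a conjugate of \<open>g\<close>. Then \<open>G\<close> is the direct product of \<open>H = \<phi>(G)\<close>
  and \<open>{\<one>, z}\<close>; yet for \<open>\<one> \<noteq> h \<in> H\<close> the elements \<open>h\<close> and \<open>h z\<close> have the same image and so are
  conjugate to each other, which is impossible in this product. So \<open>H\<close> is trivial and \<open>|G| = 2\<close>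
  (\<open>order_eq_2_if_central_kernel\<close>).
\<close>

section \<open>Twisted conjugation as a group action\<close>

definition twisted_action :: "('a, 'b) monoid_scheme \<Rightarrow> ('a \<Rightarrow> 'a) \<Rightarrow> 'a \<Rightarrow> 'a \<Rightarrow> 'a" where
  "twisted_action G \<phi> = (\<lambda>h. \<lambda>g \<in> carrier G. h \<otimes>\<^bsub>G\<^esub> g \<otimes>\<^bsub>G\<^esub> inv\<^bsub>G\<^esub> (\<phi> h))"

lemma (in group) inv_cancel_left:
  assumes "x \<in> carrier G" "y \<in> carrier G"
  shows "inv x \<otimes> (x \<otimes> y) = y" "x \<otimes> (inv x \<otimes> y) = y"
  using assms by (simp_all add: m_assoc[symmetric])

lemma (in group) twisted_action_group_action:
  assumes "\<phi> \<in> hom G G"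
  shows "group_action G (carrier G) (twisted_action G \<phi>)"
proof -
  interpret \<phi>: group_hom G G \<phi>
    using assms by unfold_locales
  have bij: "twisted_action G \<phi> h \<in> Bij (carrier G)" if h: "h \<in> carrier G" for h
  proof -
    have "bij_betw (twisted_action G \<phi> h) (carrier G) (carrier G)"
      by (rule bij_betw_byWitness[where f' = "\<lambda>g. inv h \<otimes> g \<otimes> \<phi> h"])
        (use h in \<open>auto simp: twisted_action_def m_assoc inv_cancel_left\<close>)
    then show ?thesis
      by (simp add: Bij_def twisted_action_def)
  qed
  have "twisted_action G \<phi> (h \<otimes> k) =
      compose (carrier G) (twisted_action G \<phi> h) (twisted_action G \<phi> k)"
    if "h \<in> carrier G" "k \<in> carrier G" for h k
    using that by (auto simp: twisted_action_def compose_def m_assoc inv_mult_group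
        intro!: restrict_ext)
  then have "twisted_action G \<phi> \<in> hom G (BijGroup (carrier G))"
    using bij by (auto simp: hom_def BijGroup_def)
  then show ?thesis
    by (simp add: group_action_def group_hom_def group_hom_axioms_def group_BijGroup is_group)
qed

lemma (in group) quotient_twisted_conj:
  assumes "\<phi> \<in> hom G G"
  shows "carrier G // twisted_conj G \<phi> = orbits G (carrier G) (twisted_action G \<phi>)"
proof -
  interpret \<phi>: group_hom G G \<phi>
    using assms by unfold_locales
  have "twisted_conj G \<phi> `` {x} = orbit G (twisted_action G \<phi>) x" if x: "x \<in> carrier G" for x
  proof -
    have "sym (twisted_conj G \<phi>)"
      using equiv_twisted_conj[OF assms] by (auto simp: equiv_def)
    then have "twisted_conj G \<phi> `` {x} = {y. (y, x) \<in> twisted_conj G \<phi>}"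
      by (auto dest: symD)
    also have "\<dots> = orbit G (twisted_action G \<phi>) x"
      using x by (auto simp: twisted_conj_def orbit_def twisted_action_def)
    finally show ?thesis .
  qed
  then show ?thesis
    by (auto simp: quotient_def orbits_def)
qed

text \<open>
  The value \<open>2\<close> is missing from the spectrum of a group of odd order by this parity obstruction:
  an odd number is being partitioned into orbits of odd size.
\<close>

lemma (in group) odd_reidemeister_number:
  assumes fin: "finite (carrier G)" and odd: "odd (order G)" and hom: "\<phi> \<in> hom G G"
  shows "odd (reidemeister_number G \<phi>)"
proof -
  interpret tw: group_action G "carrier G" "twisted_action G \<phi>"
    using hom by (rule twisted_action_group_action)
  let ?O = "orbits G (carrier G) (twisted_action G \<phi>)"
  have "odd (card C)" if "C \<in> ?O" for C
  proof -
    obtain x where "x \<in> carrier G" "C = orbit G (twisted_action G \<phi>) x"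
      using \<open>C \<in> ?O\<close> by (auto simp: orbits_def)
    then have "card C dvd order G"
      using tw.orbit_stabilizer_theorem[of x] by (auto intro: dvdI[OF sym])
    then show ?thesis
      using odd dvd_trans by blast
  qed
  then have "{C \<in> ?O. odd (card C)} = ?O"
    by blast
  moreover have "finite ?O"
    using fin by (simp add: orbits_def Setcompr_eq_image)
  moreover have "(\<Sum>C\<in>?O. card C) = order G"
    using tw.disjoint_sum[OF fin, of "\<lambda>_. 1::nat"] by (simp add: order_def)
  ultimately have "odd (card ?O)"
    using odd even_sum_iff[of ?O card] by simp
  then show ?thesis
    by (simp add: reidemeister_number_def quotient_twisted_conj[OF hom])
qed

section \<open>Reidemeister numbers count fixed conjugacy classes\<close>

abbreviation conj_action :: "('a, 'b) monoid_scheme \<Rightarrow> 'a \<Rightarrow> 'a \<Rightarrow> 'a" where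
  "conj_action G \<equiv> (\<lambda>g. \<lambda>h \<in> carrier G. g \<otimes>\<^bsub>G\<^esub> h \<otimes>\<^bsub>G\<^esub> inv\<^bsub>G\<^esub> g)"

abbreviation conj_class :: "('a, 'b) monoid_scheme \<Rightarrow> 'a \<Rightarrow> 'a set" where
  "conj_class G \<equiv> orbit G (conj_action G)"

abbreviation conj_classes :: "('a, 'b) monoid_scheme \<Rightarrow> 'a set set" where
  "conj_classes G \<equiv> orbits G (carrier G) (conj_action G)"

context group
begin

lemma mem_conj_class_iff:
  assumes "x \<in> carrier G"
  shows "y \<in> conj_class G x \<longleftrightarrow> (\<exists>g\<in>carrier G. y = g \<otimes> x \<otimes> inv g)"
  using assms by (auto simp: orbit_def)

lemma conj_class_in_conj_classes: "x \<in> carrier G \<Longrightarrow> conj_class G x \<in> conj_classes G"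
  by (auto simp: orbits_def)

lemma conj_class_subset: "x \<in> carrier G \<Longrightarrow> conj_class G x \<subseteq> carrier G"
  by (auto simp: orbit_def)

lemma conj_class_refl: "x \<in> carrier G \<Longrightarrow> x \<in> conj_class G x"
  by (rule group_action.orbit_refl[OF action_by_conjugation])

lemma conj_class_eqI:
  assumes "x \<in> carrier G" "y \<in> conj_class G x"
  shows "conj_class G y = conj_class G x"
proof -
  have y: "y \<in> carrier G"
    using assms conj_class_subset by blast
  then show ?thesis
    using group_action.disjoint_union[OF action_by_conjugation
        conj_class_in_conj_classes conj_class_in_conj_classes] assms conj_class_refl by blast
qed

lemma conj_class_center: "z \<in> center G \<Longrightarrow> conj_class G z = {z}"
proof -
  assume "z \<in> center G"
  then have z: "z \<in> carrier G" "\<And>g. g \<in> carrier G \<Longrightarrow> g \<otimes> z \<otimes> inv g = z"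
    by (auto simp: center_def m_assoc inv_cancel_left)
  then show "conj_class G z = {z}"
    using conj_class_refl[of z] by (auto simp: mem_conj_class_iff)
qed

lemma conj_class_one: "conj_class G \<one> = {\<one>}"
  by (rule conj_class_center) (simp add: center_def)

lemma one_in_conj_class:
  assumes x: "x \<in> carrier G" and "\<one> \<in> conj_class G x"
  shows "x = \<one>"
proof -
  have "conj_class G x = {\<one>}"
    using conj_class_eqI[OF assms] conj_class_one by simp
  then show ?thesis
    using conj_class_refl[OF x] by simp
qed

lemma hom_image_conj_class_iff:
  assumes hom: "\<phi> \<in> hom G G" and x: "x \<in> carrier G"
  shows "\<phi> ` conj_class G x \<subseteq> conj_class G x \<longleftrightarrow> \<phi> x \<in> conj_class G x"
proof
  assume "\<phi> x \<in> conj_class G x"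
  interpret \<phi>: group_hom G G \<phi>
    using hom by unfold_locales
  show "\<phi> ` conj_class G x \<subseteq> conj_class G x"
  proof clarify
    fix y assume "y \<in> conj_class G x"
    then obtain g where g: "g \<in> carrier G" "y = g \<otimes> x \<otimes> inv g"
      using x by (auto simp: mem_conj_class_iff)
    then have "\<phi> y = \<phi> g \<otimes> \<phi> x \<otimes> inv (\<phi> g)"
      using x by simp
    then have "\<phi> y \<in> conj_class G (\<phi> x)"
      using g x \<phi>.hom_closed mem_conj_class_iff by blast
    then show "\<phi> y \<in> conj_class G x"
      using conj_class_eqI[OF x \<open>\<phi> x \<in> conj_class G x\<close>] by simp
  qed
qed (use x conj_class_refl in blast)

text \<open>
  The fixed points of \<open>h\<close> under twisted conjugation are the solutions \<open>g\<close> of \<open>h = g \<phi>(h) g\<inverse>\<close>: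
  none unless \<open>h\<close> and \<open>\<phi>(h)\<close> are conjugate, and otherwise a coset of the centraliser of \<open>h\<close>.
\<close>

lemma card_invariants_twisted_action:
  assumes hom: "\<phi> \<in> hom G G" and h: "h \<in> carrier G"
  shows "card (invariants (carrier G) (twisted_action G \<phi>) h) =
    (if \<phi> h \<in> conj_class G h then card (stabilizer G (conj_action G) h) else 0)"
proof -
  interpret \<phi>: group_hom G G \<phi>
    using hom by unfold_locales
  let ?I = "invariants (carrier G) (twisted_action G \<phi>) h"
  have mem_I: "g \<in> ?I \<longleftrightarrow> g \<in> carrier G \<and> h \<otimes> g = g \<otimes> \<phi> h" for g
    using h by (auto simp: invariants_def twisted_action_def inv_solve_right inv_solve_right')
  show ?thesis
  proof (cases "\<phi> h \<in> conj_class G h")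
    case True
    then obtain k where k: "k \<in> carrier G" "\<phi> h = k \<otimes> h \<otimes> inv k"
      using h by (auto simp: mem_conj_class_iff)
    let ?S = "stabilizer G (conj_action G) h"
    have mem_S: "c \<in> ?S \<longleftrightarrow> c \<in> carrier G \<and> c \<otimes> h = h \<otimes> c" for c
      using h by (auto simp: stabilizer_def inv_solve_right inv_solve_right')
    have "bij_betw (\<lambda>c. c \<otimes> inv k) ?S ?I"
    proof (rule bij_betw_byWitness[where f' = "\<lambda>g. g \<otimes> k"])
      show "(\<lambda>c. c \<otimes> inv k) ` ?S \<subseteq> ?I"
      proof clarify
        fix c assume "c \<in> ?S"
        then have c: "c \<in> carrier G" "c \<otimes> h = h \<otimes> c"
          by (simp_all add: mem_S)
        have "(c \<otimes> inv k) \<otimes> \<phi> h = (c \<otimes> h) \<otimes> inv k"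
          using c(1) k h by (simp add: m_assoc inv_cancel_left)
        then show "c \<otimes> inv k \<in> ?I"
          using c k(1) h by (simp add: mem_I m_assoc[symmetric])
      qed
      show "(\<lambda>g. g \<otimes> k) ` ?I \<subseteq> ?S"
      proof clarify
        fix g assume "g \<in> ?I"
        then have g: "g \<in> carrier G" "h \<otimes> g = g \<otimes> \<phi> h"
          by (simp_all add: mem_I)
        have "h \<otimes> (g \<otimes> k) = (g \<otimes> \<phi> h) \<otimes> k"
          using g k(1) h by (simp add: m_assoc[symmetric])
        also have "\<dots> = g \<otimes> k \<otimes> h"
          using g(1) k h by (simp add: m_assoc)
        finally show "g \<otimes> k \<in> ?S"
          using g k h by (simp add: mem_S)
      qed
    qed (use k in \<open>auto simp: mem_S mem_I m_assoc\<close>)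
    then have "card ?I = card ?S"
      by (rule bij_betw_same_card[symmetric])
    then show ?thesis
      using True by simp
  next
    case False
    have "?I = {}"
    proof (rule ccontr)
      assume "?I \<noteq> {}"
      then obtain g where g: "g \<in> carrier G" "h \<otimes> g = g \<otimes> \<phi> h"
        using mem_I by blast
      then have "\<phi> h = inv g \<otimes> h \<otimes> inv (inv g)"
        using h by (simp add: m_assoc inv_solve_left)
      then show False
        using False g(1) h mem_conj_class_iff inv_closed by blast
    qed
    then show ?thesis
      using False by simp
  qed
qed

text \<open>
  By Burnside's lemma for twisted conjugation, \<open>R(\<phi>) |G|\<close> is the sum of the centraliser orders of
  the elements \<open>h\<close> conjugate to \<open>\<phi>(h)\<close>; each class of such elements contributes \<open>|G|\<close> to it.
\<close>

theorem reidemeister_number_eq_fixed_classes: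
  assumes fin: "finite (carrier G)" and hom: "\<phi> \<in> hom G G"
  shows "reidemeister_number G \<phi> = card {C \<in> conj_classes G. \<phi> ` C \<subseteq> C}"
proof -
  interpret tw: group_action G "carrier G" "twisted_action G \<phi>"
    using hom by (rule twisted_action_group_action)
  interpret cj: group_action G "carrier G" "conj_action G"
    by (rule action_by_conjugation)
  let ?f = "\<lambda>h. if \<phi> h \<in> conj_class G h then card (stabilizer G (conj_action G) h) else 0"
  have finO: "finite (conj_classes G)"
    using fin by (simp add: orbits_def Setcompr_eq_image)
  have class_sum: "(\<Sum>h\<in>C. ?f h) = (if \<phi> ` C \<subseteq> C then order G else 0)"
    if "C \<in> conj_classes G" for C
  proof -
    have *: "\<phi> h \<in> conj_class G h \<longleftrightarrow> \<phi> ` C \<subseteq> C" if "h \<in> C" for h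
    proof -
      obtain x where x: "x \<in> carrier G" "C = conj_class G x"
        using \<open>C \<in> conj_classes G\<close> by (auto simp: orbits_def)
      then have "h \<in> carrier G" "C = conj_class G h"
        using \<open>h \<in> C\<close> conj_class_subset conj_class_eqI by blast+
      then show ?thesis
        using hom_image_conj_class_iff[OF hom] by simp
    qed
    have "(\<Sum>h\<in>C. ?f h) =
        (\<Sum>h\<in>C. if \<phi> ` C \<subseteq> C then card (stabilizer G (conj_action G) h) else 0)"
      by (rule sum.cong) (auto simp: *)
    then show ?thesis
      using cj.card_stablizer_sum[OF fin that] by simp
  qed
  have "reidemeister_number G \<phi> * order G =
      (\<Sum>h\<in>carrier G. card (invariants (carrier G) (twisted_action G \<phi>) h))"
    using tw.burnside[OF fin fin] by (simp add: reidemeister_number_def quotient_twisted_conj[OF hom])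
  also have "\<dots> = (\<Sum>h\<in>carrier G. ?f h)"
    by (rule sum.cong) (simp_all add: card_invariants_twisted_action[OF hom])
  also have "\<dots> = (\<Sum>C\<in>conj_classes G. \<Sum>h\<in>C. ?f h)"
    by (rule cj.disjoint_sum[OF fin, symmetric])
  also have "\<dots> = (\<Sum>C\<in>conj_classes G. if \<phi> ` C \<subseteq> C then order G else 0)"
    by (rule sum.cong) (simp_all add: class_sum)
  also have "\<dots> = card {C \<in> conj_classes G. \<phi> ` C \<subseteq> C} * order G"
    using finO by (simp add: sum.If_cases Collect_conj_eq Int_commute)
  finally show ?thesis
    using fin order_gt_0_iff_finite by simp
qed

section \<open>Endomorphisms that move exactly one conjugacy class\<close>

lemma moved_class_unique:
  assumes fin: "finite (carrier G)" and hom: "\<phi> \<in> hom G G"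
    and R: "Suc (reidemeister_number G \<phi>) = conj_class_number G"
  obtains d where "d \<in> carrier G" "\<phi> d \<notin> conj_class G d"
    "\<And>x. x \<in> carrier G \<Longrightarrow> \<phi> x \<notin> conj_class G x \<Longrightarrow> x \<in> conj_class G d"
proof -
  let ?F = "{C \<in> conj_classes G. \<phi> ` C \<subseteq> C}"
  have "finite (conj_classes G)"
    using fin by (simp add: orbits_def Setcompr_eq_image)
  then have "card (conj_classes G - ?F) = 1"
    using R by (subst card_Diff_subset)
      (auto simp: conj_class_number_def reidemeister_number_eq_fixed_classes[OF fin hom])
  then obtain D where D: "conj_classes G - ?F = {D}"
    by (rule card_1_singletonE)
  then have "D \<in> conj_classes G - ?F"
    by simp
  then have "D \<in> conj_classes G" "\<not> \<phi> ` D \<subseteq> D"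
    by simp_all
  then obtain d where d: "d \<in> carrier G" "D = conj_class G d"
    by (auto simp: orbits_def)
  show ?thesis
  proof
    show "\<phi> d \<notin> conj_class G d"
      using \<open>\<not> \<phi> ` D \<subseteq> D\<close> hom_image_conj_class_iff[OF hom d(1)] d(2) by simp
    fix x assume x: "x \<in> carrier G" "\<phi> x \<notin> conj_class G x"
    then have "conj_class G x \<in> conj_classes G - ?F"
      using hom_image_conj_class_iff[OF hom x(1)] conj_class_in_conj_classes by simp
    then have "conj_class G x = conj_class G d"
      unfolding D d(2) by simp
    then show "x \<in> conj_class G d"
      using conj_class_refl[OF x(1)] by simp
  qed (rule d)
qed

text \<open>
  If \<open>d\<close> represents the moved class, then \<open>\<phi>(d)\<close> lies outside it, so \<open>\<phi>(d)\<close> is conjugate to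
  \<open>\<phi>(\<phi>(d))\<close>. An automorphism could be cancelled from this, giving \<open>d\<close> conjugate to \<open>\<phi>(d)\<close>.
\<close>

lemma not_inj_if_moves_one_class:
  assumes fin: "finite (carrier G)" and hom: "\<phi> \<in> hom G G"
    and R: "Suc (reidemeister_number G \<phi>) = conj_class_number G"
  shows "\<not> inj_on \<phi> (carrier G)"
proof
  assume inj: "inj_on \<phi> (carrier G)"
  interpret \<phi>: group_hom G G \<phi>
    using hom by unfold_locales
  have surj: "\<phi> ` carrier G = carrier G"
    using fin inj by (intro endo_inj_surj) auto
  obtain d where d: "d \<in> carrier G" "\<phi> d \<notin> conj_class G d"
    and uniq: "\<And>x. x \<in> carrier G \<Longrightarrow> \<phi> x \<notin> conj_class G x \<Longrightarrow> x \<in> conj_class G d"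
    using moved_class_unique[OF fin hom R] by blast
  have "\<phi> (\<phi> d) \<in> conj_class G (\<phi> d)"
    using uniq[of "\<phi> d"] d by auto
  then obtain g where "g \<in> carrier G" "\<phi> (\<phi> d) = g \<otimes> \<phi> d \<otimes> inv g"
    using d mem_conj_class_iff[of "\<phi> d"] by auto
  moreover from this obtain k where k: "k \<in> carrier G" "g = \<phi> k"
    using surj by (metis imageE)
  ultimately have "\<phi> (\<phi> d) = \<phi> (k \<otimes> d \<otimes> inv k)"
    using d by simp
  then have "\<phi> d = k \<otimes> d \<otimes> inv k"
    using inj_onD[OF inj] d(1) k(1) by simp
  then show False
    using d(2) mem_conj_class_iff[OF d(1)] k(1) by blast
qed

text \<open>
  The centraliser of \<open>d \<noteq> \<one>\<close> contains \<open>\<one>\<close> and \<open>d\<close>, so the class of \<open>d\<close> fills at most half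
  of \<open>G\<close>.
\<close>

lemma order_le_2_if_two_classes:
  assumes fin: "finite (carrier G)" and d: "d \<in> carrier G" "d \<noteq> \<one>"
    and cls: "carrier G - {\<one>} \<subseteq> conj_class G d"
  shows "order G \<le> 2"
proof -
  interpret cj: group_action G "carrier G" "conj_action G"
    by (rule action_by_conjugation)
  let ?S = "stabilizer G (conj_action G) d"
  have "\<one> \<in> ?S" "d \<in> ?S"
    using d by (simp_all add: stabilizer_def m_assoc)
  then have "{\<one>, d} \<subseteq> ?S"
    by simp
  moreover have "finite ?S"
    using fin by (simp add: stabilizer_def)
  ultimately have "card {\<one>, d} \<le> card ?S"
    by (intro card_mono)
  then have "card (conj_class G d) * 2 \<le> card (conj_class G d) * card ?S"
    using d(2) by (intro mult_le_mono2) simp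
  also have "\<dots> = order G"
    by (rule cj.orbit_stabilizer_theorem[OF d(1)])
  finally have "card (conj_class G d) * 2 \<le> order G" .
  moreover have "card (carrier G - {\<one>}) \<le> card (conj_class G d)"
    by (rule card_mono[OF finite_subset[OF conj_class_subset[OF d(1)] fin] cls])
  then have "order G - 1 \<le> card (conj_class G d)"
    using fin by (simp add: order_def)
  ultimately show ?thesis
    by linarith
qed

text \<open>
  The centrality of \<open>z\<close> makes the moved class a single element, which forces \<open>G\<close> to be the product
  of \<open>\<phi>(G)\<close> and \<open>{\<one>, z}\<close> with \<open>h\<close> conjugate to \<open>h z\<close> for every \<open>h \<noteq> \<one>\<close> in \<open>\<phi>(G)\<close>.
\<close>

lemma order_eq_2_if_central_kernel:
  assumes fin: "finite (carrier G)" and hom: "\<phi> \<in> hom G G"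
    and R: "Suc (reidemeister_number G \<phi>) = conj_class_number G"
    and z: "z \<in> center G" "z \<noteq> \<one>" "\<phi> z = \<one>"
  shows "order G = 2"
proof -
  interpret \<phi>: group_hom G G \<phi>
    using hom by unfold_locales
  obtain d where d: "d \<in> carrier G"
    and uniq: "\<And>x. x \<in> carrier G \<Longrightarrow> \<phi> x \<notin> conj_class G x \<Longrightarrow> x \<in> conj_class G d"
    using moved_class_unique[OF fin hom R] by blast
  have zG: "z \<in> carrier G" and zcomm: "\<And>g. g \<in> carrier G \<Longrightarrow> z \<otimes> g = g \<otimes> z"
    using z by (auto simp: center_def)
  have "z \<in> conj_class G d"
    using uniq[OF zG] conj_class_center[OF z(1)] z by simp
  then have D: "conj_class G d = {z}"
    using conj_class_eqI[OF d, of z] conj_class_center[OF z(1)] by simp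
  have fixed: "\<phi> g \<in> conj_class G g" if "g \<in> carrier G" "g \<noteq> z" for g
    using uniq[of g] that D by auto
  have kernel: "g \<in> {\<one>, z}" if g: "g \<in> carrier G" "\<phi> g = \<one>" for g
  proof (rule ccontr)
    assume "g \<notin> {\<one>, z}"
    then have "\<one> \<in> conj_class G g"
      using fixed[of g] g by simp
    then show False
      using one_in_conj_class[OF g(1)] \<open>g \<notin> {\<one>, z}\<close> by simp
  qed
  define H where "H = \<phi> ` carrier G"
  interpret H: subgroup H G
    unfolding H_def by (rule \<phi>.img_is_subgroup)
  have zH: "z \<notin> H"
  proof
    assume "z \<in> H"
    then obtain w where w: "w \<in> carrier G" "z = \<phi> w"
      by (auto simp: H_def)
    then have "w \<noteq> z"
      using z by auto
    then have "z \<in> conj_class G w"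
      using fixed w by simp
    then have "conj_class G w = {z}"
      using conj_class_eqI[OF w(1), of z] conj_class_center[OF z(1)] by simp
    then show False
      using conj_class_refl[OF w(1)] \<open>w \<noteq> z\<close> by simp
  qed
  \<comment> \<open>As \<open>H\<close> meets the kernel trivially, \<open>\<phi>\<close> permutes \<open>H\<close>, and \<open>H\<close> is a complement to \<open>{\<one>, z}\<close>.\<close>
  have diff: "g \<otimes> inv h \<in> {\<one>, z}" if "g \<in> carrier G" "h \<in> carrier G" "\<phi> g = \<phi> h" for g h
    using that by (intro kernel) simp_all
  have "inj_on \<phi> H"
  proof (rule inj_onI)
    fix g h assume gh: "g \<in> H" "h \<in> H" "\<phi> g = \<phi> h"
    then have "g \<otimes> inv h \<in> {\<one>, z}"
      by (intro diff) auto
    moreover have "g \<otimes> inv h \<in> H"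
      using gh by simp
    ultimately have "g \<otimes> inv h = \<one>"
      using zH by auto
    then show "g = h"
      using gh inv_solve_right'[of \<one> g h] by simp
  qed
  moreover have "\<phi> ` H \<subseteq> H"
    using H.subset by (auto simp: H_def)
  moreover have "finite H"
    using fin by (simp add: H_def)
  ultimately have permH: "\<phi> ` H = H"
    by (intro endo_inj_surj)
  have decomp: "\<exists>h\<in>H. g = h \<or> g = z \<otimes> h" if g: "g \<in> carrier G" for g
  proof -
    have "\<phi> g \<in> \<phi> ` H"
      using g permH by (auto simp: H_def)
    then obtain h where h: "h \<in> H" "\<phi> g = \<phi> h"
      by blast
    then have "g \<otimes> inv h = \<one> \<or> g \<otimes> inv h = z"
      using diff[of g h] g by auto
    then have "g = \<one> \<otimes> h \<or> g = z \<otimes> h"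
      using g H.mem_carrier[OF h(1)] zG one_closed inv_solve_right'[of _ g h] by blast
    then show ?thesis
      using h by auto
  qed
  have trivial: "h = \<one>" if h: "h \<in> H" for h
  proof (rule ccontr)
    assume "h \<noteq> \<one>"
    have hG: "h \<in> carrier G" and zhG: "z \<otimes> h \<in> carrier G"
      using h zG by auto
    have "z \<otimes> h \<noteq> z"
      using \<open>h \<noteq> \<one>\<close> hG zG by simp
    then have "\<phi> h \<in> conj_class G (z \<otimes> h)"
      using fixed[OF zhG] z hG zG by simp
    moreover have "\<phi> h \<in> conj_class G h"
      using fixed[of h] hG h zH by blast
    ultimately have "conj_class G h = conj_class G (z \<otimes> h)"
      using conj_class_eqI[OF hG, of "\<phi> h"] conj_class_eqI[OF zhG, of "\<phi> h"] by simp
    then obtain x where x: "x \<in> carrier G" "z \<otimes> h = x \<otimes> h \<otimes> inv x"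
      using conj_class_refl[OF zhG] mem_conj_class_iff[OF hG] by auto
    then obtain y where y: "y \<in> H" "x = y \<or> x = z \<otimes> y"
      using decomp by blast
    have yG: "y \<in> carrier G"
      using y by simp
    \<comment> \<open>The central factor of \<open>x\<close> cancels in the conjugation.\<close>
    have "z \<otimes> y \<otimes> h \<otimes> inv (z \<otimes> y) = y \<otimes> h \<otimes> inv y"
    proof -
      have "z \<otimes> y \<otimes> h \<otimes> inv (z \<otimes> y) = (z \<otimes> (y \<otimes> h \<otimes> inv y)) \<otimes> inv z"
        using yG hG zG by (simp add: m_assoc inv_mult_group)
      also have "\<dots> = ((y \<otimes> h \<otimes> inv y) \<otimes> z) \<otimes> inv z"
        using yG hG zcomm by simp
      also have "\<dots> = y \<otimes> h \<otimes> inv y"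
        using yG hG zG by (simp add: m_assoc)
      finally show ?thesis .
    qed
    then have "z \<otimes> h = y \<otimes> h \<otimes> inv y"
      using x y by auto
    then have "z \<otimes> h \<in> H"
      using y h by simp
    then have "z \<otimes> h \<otimes> inv h \<in> H"
      using h by blast
    then show False
      using zH zG hG by (simp add: m_assoc)
  qed
  have "carrier G = {\<one>, z}"
    using decomp trivial zG by force
  then show ?thesis
    using z by (simp add: order_def)
qed

section \<open>Central elements in normal subgroups\<close>

text \<open>
  Choose \<open>m\<close> such that \<open>N\<close> meets the \<open>m\<close>-th term of the lower central series nontrivially, but
  the next term trivially;
  commutators of elements of this intersection with \<open>G\<close> stay in \<open>N\<close> and move one term down, hence
  are trivial.
\<close>

lemma nilpotent_normal_meets_center:
  assumes nil: "nilpotent_group G" and N: "N \<lhd> G" "N \<noteq> {\<one>}"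
  obtains z where "z \<in> N" "z \<in> center G" "z \<noteq> \<one>"
proof -
  interpret N: normal N G
    by (rule N)
  let ?\<gamma> = "lower_central_series G"
  let ?P = "\<lambda>n. N \<inter> ?\<gamma> n \<subseteq> {\<one>}"
  obtain c where "?\<gamma> c = {\<one>}"
    using nil unfolding nilpotent_group_def by blast
  then have "?P c"
    by simp
  moreover have "\<not> N \<subseteq> {\<one>}"
    using N(2) N.one_closed subset_singletonD by fastforce
  then have "\<not> ?P 0"
    using N.subset by (simp add: Int_absorb2)
  ultimately have "\<exists>m<c. (\<forall>i\<le>m. \<not> ?P i) \<and> ?P (Suc m)"
    by (rule ex_least_nat_less)
  then obtain m where m: "\<not> ?P m" "?P (Suc m)"
    by (metis order_refl)
  then obtain z where z: "z \<in> N" "z \<in> ?\<gamma> m" "z \<noteq> \<one>"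
    by blast
  have "z \<otimes> g = g \<otimes> z" if g: "g \<in> carrier G" for g
  proof -
    have zG: "z \<in> carrier G"
      using z by simp
    let ?k = "z \<otimes> g \<otimes> inv z \<otimes> inv g"
    have "?k \<in> ?\<gamma> (Suc m)"
      using z g by (auto simp: commutator_subgroup_def intro!: generate.incl)
    moreover have "z \<otimes> (g \<otimes> inv z \<otimes> inv g) \<in> N"
      using z g N.inv_op_closed2 by simp
    then have "?k \<in> N"
      using zG g by (simp add: m_assoc)
    ultimately have "?k = \<one>"
      using m(2) by blast
    then have "z \<otimes> g \<otimes> inv z = g"
      using zG g inv_solve_right'[of \<one> "z \<otimes> g \<otimes> inv z" g] by simp
    then show ?thesis
      using zG g inv_solve_right'[of g "z \<otimes> g" z] by simp
  qed
  then show ?thesis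
    using z that by (simp add: center_def)
qed

text \<open>
  The image of a normal subgroup \<open>N\<close> in the simple group \<open>G / Z(G)\<close> is trivial, so that \<open>N\<close> is
  central, or everything; in the second case \<open>G = Z(G) N\<close>, all commutators lie in \<open>N\<close>, and \<open>N\<close> is
  all of the perfect group \<open>G\<close>.
\<close>

lemma quasisimple_normal_subgroup:
  assumes qs: "quasisimple G" and N: "N \<lhd> G"
  shows "N \<subseteq> center G \<or> N = carrier G"
proof -
  interpret N: normal N G
    by (rule N)
  interpret Z: normal "center G" G
    by (rule center_normal)
  interpret Q: simple_group "G Mod center G"
    using qs by (simp add: quasisimple_def)
  let ?\<pi> = "\<lambda>a. center G #> a"
  have "group_hom G (G Mod center G) ?\<pi>"
    using Z.r_coset_hom_Mod by unfold_locales
  moreover have "?\<pi> ` carrier G = carrier (G Mod center G)"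
    by (auto simp: FactGroup_def RCOSETS_def)
  ultimately have "(?\<pi> ` N) \<lhd> (G Mod center G)"
    by (rule N.surj_hom_normal_subgroup)
  then have "?\<pi> ` N = carrier (G Mod center G) \<or> ?\<pi> ` N = {\<one>\<^bsub>G Mod center G\<^esub>}"
    by (rule Q.no_real_normal_subgroup)
  moreover have "\<one>\<^bsub>G Mod center G\<^esub> = center G"
    by (simp add: FactGroup_def)
  ultimately consider "?\<pi> ` N = {center G}" | "?\<pi> ` N = carrier (G Mod center G)"
    by argo
  then show ?thesis
  proof cases
    case 1
    have "N \<subseteq> center G"
    proof
      fix n assume n: "n \<in> N"
      then have "?\<pi> n \<in> ?\<pi> ` N"
        by (rule imageI)
      then have "?\<pi> n = center G"
        unfolding 1 by simp
      then show "n \<in> center G"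
        using rcos_self[OF N.mem_carrier[OF n] Z.subgroup_axioms] by simp
    qed
    then show ?thesis ..
  next
    case 2
    have comm: "g \<otimes> h \<otimes> inv g \<otimes> inv h \<in> N" if gh: "g \<in> carrier G" "h \<in> carrier G" for g h
    proof -
      have "?\<pi> g \<in> ?\<pi> ` N"
        using gh unfolding 2 by (auto simp: FactGroup_def RCOSETS_def)
      then obtain n where n: "n \<in> N" "?\<pi> g = ?\<pi> n"
        by (metis imageE)
      then have "g \<in> center G #> n"
        using rcos_self[OF gh(1) Z.subgroup_axioms] by simp
      then obtain z where z: "z \<in> center G" "g = z \<otimes> n"
        by (auto simp: r_coset_def)
      have zG: "z \<in> carrier G" and nG: "n \<in> carrier G"
        using z n by auto
      have "g \<otimes> h \<otimes> inv g = z \<otimes> (n \<otimes> h \<otimes> inv n) \<otimes> inv z"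
        using z zG nG gh by (simp add: m_assoc inv_mult_group)
      also have "\<dots> = (n \<otimes> h \<otimes> inv n) \<otimes> z \<otimes> inv z"
      proof -
        have "n \<otimes> h \<otimes> inv n \<in> carrier G"
          using nG gh(2) by simp
        then have "z \<otimes> (n \<otimes> h \<otimes> inv n) = (n \<otimes> h \<otimes> inv n) \<otimes> z"
          using z(1) unfolding center_def by blast
        then show ?thesis
          by (rule arg_cong)
      qed
      also have "\<dots> = n \<otimes> h \<otimes> inv n"
        using zG nG gh(2) by (simp add: m_assoc)
      finally have "g \<otimes> h \<otimes> inv g \<otimes> inv h = n \<otimes> h \<otimes> inv n \<otimes> inv h"
        by (simp only:)
      also have "\<dots> = n \<otimes> (h \<otimes> inv n \<otimes> inv h)"
        using nG gh(2) by (simp add: m_assoc)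
      also have "\<dots> \<in> N"
        using n(1) gh(2) N.inv_op_closed2 by simp
      finally show ?thesis .
    qed
    have "derived_set G (carrier G) \<subseteq> N"
      using comm by (intro UN_least) simp
    then have "derived G (carrier G) \<subseteq> N"
      unfolding derived_def by (rule generate_subgroup_incl) (rule N.subgroup_axioms)
    moreover have "derived G (carrier G) = carrier G"
      using qs by (simp add: quasisimple_def perfect_def)
    ultimately show ?thesis
      using N.subset by simp
  qed
qed

section \<open>The spectrum is not full\<close>

lemma conj_class_number_ge_2:
  assumes fin: "finite (carrier G)" and "order G > 1"
  shows "conj_class_number G \<ge> 2"
proof -
  have "\<not> carrier G \<subseteq> {\<one>}"
    using assms card_mono[of "{\<one>}" "carrier G"] by (auto simp: order_def)
  then obtain x where x: "x \<in> carrier G" "x \<noteq> \<one>"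
    by blast
  have "conj_class G x \<noteq> conj_class G \<one>"
    using x conj_class_refl[of x] conj_class_one by auto
  moreover have "{conj_class G \<one>, conj_class G x} \<subseteq> conj_classes G"
    using x by (simp add: conj_class_in_conj_classes)
  moreover have "finite (conj_classes G)"
    using fin by (simp add: orbits_def Setcompr_eq_image)
  ultimately have "2 \<le> card (conj_classes G)"
    using card_mono[of "conj_classes G" "{conj_class G \<one>, conj_class G x}"] by simp
  then show ?thesis
    by (simp add: conj_class_number_def)
qed

text \<open>
  The kernel of an endomorphism moving one class would contain a central element other than \<open>\<one>\<close>,
  or be all of \<open>G\<close>. In the latter case \<open>\<phi>\<close> moves every class but \<open>{\<one>}\<close>, so that
  there are only two classes.
\<close>

lemma reidemeister_number_ne_pred_conj_class_number:
  assumes fin: "finite (carrier G)" and ord: "order G > 2"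
    and struct: "nilpotent_group G \<or> quasisimple G" and hom: "\<phi> \<in> hom G G"
  shows "Suc (reidemeister_number G \<phi>) \<noteq> conj_class_number G"
proof
  assume R: "Suc (reidemeister_number G \<phi>) = conj_class_number G"
  interpret \<phi>: group_hom G G \<phi>
    using hom by unfold_locales
  let ?N = "kernel G G \<phi>"
  have N: "?N \<lhd> G" "?N \<noteq> {\<one>}"
    using \<phi>.normal_kernel not_inj_if_moves_one_class[OF fin hom R] \<phi>.inj_iff_trivial_ker
    by simp_all
  have no_central: "z = \<one>" if "z \<in> ?N" "z \<in> center G" for z
  proof (rule ccontr)
    assume "z \<noteq> \<one>"
    moreover have "\<phi> z = \<one>"
      using that(1) by (simp add: kernel_def)
    ultimately have "order G = 2"
      by (rule order_eq_2_if_central_kernel[OF fin hom R that(2)])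
    then show False
      using ord by simp
  qed
  from struct show False
  proof
    assume 1: "nilpotent_group G"
    then show False
      using nilpotent_normal_meets_center[OF 1 N] no_central by blast
  next
    assume 2: "quasisimple G"
    have "\<one> \<in> ?N"
      by (simp add: kernel_def)
    then have "\<not> ?N \<subseteq> center G"
      using N(2) no_central by blast
    then have "?N = carrier G"
      using quasisimple_normal_subgroup[OF 2 N(1)] by blast
    then have triv: "\<phi> x = \<one>" if "x \<in> carrier G" for x
      using that by (auto simp: kernel_def)
    obtain d where d: "d \<in> carrier G" "\<phi> d \<notin> conj_class G d"
      and uniq: "\<And>x. x \<in> carrier G \<Longrightarrow> \<phi> x \<notin> conj_class G x \<Longrightarrow> x \<in> conj_class G d"
      using moved_class_unique[OF fin hom R] by blast
    have "carrier G - {\<one>} \<subseteq> conj_class G d"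
    proof
      fix x assume "x \<in> carrier G - {\<one>}"
      then have "x \<in> carrier G" "\<phi> x \<notin> conj_class G x"
        using triv[of x] one_in_conj_class[of x] by auto
      then show "x \<in> conj_class G d"
        by (rule uniq)
    qed
    moreover have "d \<noteq> \<one>"
      using d triv[of d] conj_class_refl[of d] by auto
    ultimately show False
      using order_le_2_if_two_classes[OF fin d(1)] ord by simp
  qed
qed

end

theorem theorem5p8:
  fixes G :: "('a, 'b) monoid_scheme"
  assumes "group G"
    and "finite (carrier G)"
    and "order G > 2"
    and "odd (order G) \<or> nilpotent_group G \<or> quasisimple G"
  shows "\<not> full_ext_reidemeister_spectrum G"
proof
  assume "full_ext_reidemeister_spectrum G"
  then have spec: "\<exists>\<phi>\<in>hom G G. reidemeister_number G \<phi> = n"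
    if "n \<in> {1..conj_class_number G}" for n
  proof -
    have "n \<in> reidemeister_number G ` hom G G"
      using that \<open>full_ext_reidemeister_spectrum G\<close>
      by (simp add: full_ext_reidemeister_spectrum_def ext_reidemeister_spectrum_def)
    then show ?thesis
      by blast
  qed
  interpret group G
    by (rule assms(1))
  note fin = assms(2)
  have k: "conj_class_number G \<ge> 2"
    using assms by (intro conj_class_number_ge_2) simp_all
  show False
  proof (cases "odd (order G)")
    case True
    have "2 \<in> {1..conj_class_number G}"
      using k by simp
    then obtain \<phi> where "\<phi> \<in> hom G G" "reidemeister_number G \<phi> = 2"
      using spec by blast
    then show False
      using odd_reidemeister_number[OF fin True, of \<phi>] by simp
  next
    case False
    have "conj_class_number G - 1 \<in> {1..conj_class_number G}"
      using k by simp
    then obtain \<phi> where hom: "\<phi> \<in> hom G G" and "reidemeister_number G \<phi> = conj_class_number G - 1"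
      using spec by blast
    then have R: "Suc (reidemeister_number G \<phi>) = conj_class_number G"
      using k by simp
    have "nilpotent_group G \<or> quasisimple G"
      using False assms(4) by simp
    then show False
      using reidemeister_number_ne_pred_conj_class_number[OF fin assms(3) _ hom] R by simp
  qed
qed

end
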